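(* Let $p,q\in\mathbb{N}$ with $p<q$, $q$ odd, and $\Upsilon(p,q)=2$. Let $(a_n)_{n=1}^\infty=\mathcal{G}(p/q)$. For every $m\in\mathbb{N}$, $\sum_{n=1}^m 1/a_n$ is the unique best $m$-term underapproximation of $p/q$.
   Context: $\mathbb{N}$ is the set of positive integers. For $p,q\in\mathbb{N}$, $\Upsilon(p,q)$ is the smallest positive integer $j$ such that $p$ divides $q+j$. For $\theta\in(0,1]$ let $G(\theta)=\lfloor 1/\theta\rfloor+1$. The greedy algorithm $\mathcal{G}$ produces the sequence $\mathcal{G}(\theta)=(a_n)_{n=1}^\infty$ of positive integers defined by $a_1=G(\theta)$ and $a_m=G\left(\theta-\sum_{n=1}^{m-1}1/a_n\right)$ for $m\geqslant 2$. With $(a_n)_{n=1}^\infty=\mathcal{G}(\theta)$, $\sum_{n=1}^m 1/a_n$ (which is always $<\theta$) is the best $m$-term underapproximation of $\theta$ if for all $x_1,\ldots,x_m\in\mathbb{N}$ with $\sum_{n=1}^m 1/x_n<\theta$ we have $\sum_{n=1}^m 1/x_n\leqslant\sum_{n=1}^m 1/a_n$. It is the unique best one if, in addition, for positive integers $x_1\leqslant\cdots\leqslant x_m$, $\sum_{n=1}^m 1/a_n\leqslant\sum_{n=1}^m 1/x_n<\theta$ implies $x_n=a_n$ for all $1\leqslant n\leqslant m$. *)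

theory Defs
  imports Complex_Main
begin

definition Upsilon :: "nat \<Rightarrow> nat \<Rightarrow> nat" where
  "Upsilon p q = (LEAST j. 0 < j \<and> p dvd q + j)"

text \<open>Intended for \<open>0 < \<theta> \<le> 1\<close>, where the floor is positive and \<open>nat\<close> is a mere change of type.\<close>

definition G :: "real \<Rightarrow> nat" where
  "G \<theta> = nat \<lfloor>1 / \<theta>\<rfloor> + 1"

text \<open>Sequences are indexed from 1. The value at index 0 is never used.\<close>

fun greedy :: "real \<Rightarrow> nat \<Rightarrow> nat" where
  "greedy \<theta> m = G (\<theta> - (\<Sum>n = 1..<m. 1 / real (greedy \<theta> n)))"

declare greedy.simps [simp del]

text \<open>
  The first conjunct holds automatically for \<open>a = greedy \<theta>\<close> with \<open>0 < \<theta> \<le> 1\<close>. It is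
  included because the predicate is stated for an arbitrary sequence \<open>a\<close>.
\<close>

definition best_underapprox :: "real \<Rightarrow> nat \<Rightarrow> (nat \<Rightarrow> nat) \<Rightarrow> bool" where
  "best_underapprox \<theta> m a \<longleftrightarrow>
     (\<Sum>n = 1..m. 1 / real (a n)) < \<theta> \<and>
     (\<forall>x :: nat \<Rightarrow> nat.
        (\<forall>n\<in>{1..m}. 0 < x n) \<longrightarrow> (\<Sum>n = 1..m. 1 / real (x n)) < \<theta> \<longrightarrow>
        (\<Sum>n = 1..m. 1 / real (x n)) \<le> (\<Sum>n = 1..m. 1 / real (a n)))"

definition unique_best_underapprox :: "real \<Rightarrow> nat \<Rightarrow> (nat \<Rightarrow> nat) \<Rightarrow> bool" where
  "unique_best_underapprox \<theta> m a \<longleftrightarrow>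
     best_underapprox \<theta> m a \<and>
     (\<forall>x :: nat \<Rightarrow> nat.
        (\<forall>n\<in>{1..m}. 0 < x n) \<longrightarrow> mono_on {1..m} x \<longrightarrow>
        (\<Sum>n = 1..m. 1 / real (a n)) \<le> (\<Sum>n = 1..m. 1 / real (x n)) \<longrightarrow>
        (\<Sum>n = 1..m. 1 / real (x n)) < \<theta> \<longrightarrow>
        (\<forall>n\<in>{1..m}. x n = a n))"

end

theory Submission
  imports Defs "HOL-Library.Multiset"
begin

text \<open>
  Write \<open>a\<close> for the greedy sequence of \<open>p/q\<close>. Here \<open>a\<^sub>1 = (q + 2)/p\<close> with remainder
  \<open>2/(q a\<^sub>1)\<close>, and as \<open>q a\<^sub>1\<close> is odd, the remainder after \<open>m \<ge> 2\<close> terms is \<open>1/(q a\<^sub>1 \<cdots> a\<^sub>m)\<close>.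
  The remainder left by any other underapproximation \<open>x\<close> is a positive multiple of
  \<open>1/(q x\<^sub>1 \<cdots> x\<^sub>m)\<close>, so if \<open>x\<close> is at least as good as \<open>a\<close>, then
  \<open>a\<^sub>1 \<cdots> a\<^sub>m \<le> x\<^sub>1 \<cdots> x\<^sub>m\<close>. Choose \<open>k\<close> maximal with \<open>a\<^sub>k \<cdots> a\<^sub>m \<le> x\<^sub>k \<cdots> x\<^sub>m\<close>. Then
  \<open>a\<^sub>k \<cdots> a\<^sub>j \<le> x\<^sub>k \<cdots> x\<^sub>j\<close> for all \<open>j\<close> from \<open>k\<close> to \<open>m\<close>, and such a majorization of products makes
  the sum of the \<open>1/x\<^sub>i\<close> over \<open>i \<ge> k\<close> at most that of the \<open>1/a\<^sub>i\<close>, with equality only for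
  \<open>x = a\<close>. Induction on \<open>m\<close> handles the terms before \<open>k\<close>.
\<close>

section \<open>Majorization of products and sums of reciprocals\<close>

text \<open>Summation by parts in inductive form: the partial sum up to \<open>n\<close> is
  nonnegative, so lowering its weight from \<open>w n\<close> to \<open>w (Suc n)\<close> can only
  decrease the bound.\<close>

lemma abel_sum_lower_bound:
  fixes w c :: "nat \<Rightarrow> real"
  assumes "k \<le> m"
    and "\<And>j. k \<le> j \<Longrightarrow> j \<le> m \<Longrightarrow> 0 \<le> (\<Sum>i = k..j. c i)"
    and "\<And>i j. k \<le> i \<Longrightarrow> i \<le> j \<Longrightarrow> j \<le> m \<Longrightarrow> w j \<le> w i"
  shows "w m * (\<Sum>i = k..m. c i) \<le> (\<Sum>i = k..m. w i * c i)"
  using assms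
proof (induction m rule: dec_induct)
  case base
  then show ?case by simp
next
  case (step n)
  have IH: "w n * (\<Sum>i = k..n. c i) \<le> (\<Sum>i = k..n. w i * c i)"
    using step.IH step.prems by simp
  have "w (Suc n) * (\<Sum>i = k..n. c i) \<le> w n * (\<Sum>i = k..n. c i)"
    using step.hyps step.prems by (intro mult_right_mono) auto
  then show ?case
    using IH step.hyps by (simp add: distrib_left)
qed

text \<open>Logarithms turn the product hypothesis into nonnegative partial sums of
  \<open>c i = ln (x i / a i)\<close>. As \<open>x\<close> is sorted, the weights
  \<open>1 / x i\<close> are nonincreasing, so the weighted sum of \<open>c\<close> is nonnegative
  too. The inequality \<open>ln t <= t - 1\<close> at \<open>t = x i / a i\<close> gives
  \<open>c i / x i <= 1 / a i - 1 / x i\<close>, and it is strict unless \<open>t = 1\<close>, which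
  settles the equality case.\<close>

lemma sum_inverse_le_of_prod_le:
  fixes a x :: "nat \<Rightarrow> nat"
  assumes km: "k \<le> m"
    and a: "\<And>i. i \<in> {k..m} \<Longrightarrow> 0 < a i"
    and x: "\<And>i. i \<in> {k..m} \<Longrightarrow> 0 < x i"
    and mono: "mono_on {k..m} x"
    and prod: "\<And>j. j \<in> {k..m} \<Longrightarrow> (\<Prod>i = k..j. a i) \<le> (\<Prod>i = k..j. x i)"
  shows "(\<Sum>i = k..m. 1 / real (x i)) \<le> (\<Sum>i = k..m. 1 / real (a i))"
    and "(\<Sum>i = k..m. 1 / real (x i)) = (\<Sum>i = k..m. 1 / real (a i)) \<Longrightarrow>
      \<forall>i\<in>{k..m}. x i = a i"
proof -
  define c where "c i = ln (real (x i)) - ln (real (a i))" for i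
  have c: "c i = ln (real (x i) / real (a i))" if "i \<in> {k..m}" for i
    using a[OF that] x[OF that] by (simp add: c_def ln_div)
  have partial: "0 \<le> (\<Sum>i = k..j. c i)" if "k \<le> j" "j \<le> m" for j
  proof -
    have "ln (real (\<Prod>i = k..j. a i)) \<le> ln (real (\<Prod>i = k..j. x i))"
      using prod[of j] that a x
      by (subst ln_le_cancel_iff) (auto intro!: prod_pos simp del: of_nat_prod)
    moreover have "ln (real (\<Prod>i = k..j. a i)) = (\<Sum>i = k..j. ln (real (a i)))"
      using a that by (simp, subst ln_prod) auto
    moreover have "ln (real (\<Prod>i = k..j. x i)) = (\<Sum>i = k..j. ln (real (x i)))"
      using x that by (simp, subst ln_prod) auto
    ultimately show ?thesis by (simp add: c_def sum_subtractf)
  qed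
  have "1 / real (x m) * (\<Sum>i = k..m. c i) \<le> (\<Sum>i = k..m. 1 / real (x i) * c i)"
    using km partial
  proof (rule abel_sum_lower_bound)
    fix i j assume "k \<le> i" "i \<le> j" "j \<le> m"
    then show "1 / real (x j) \<le> 1 / real (x i)"
      using mono_onD[OF mono, of i j] x[of i] by (intro divide_left_mono) auto
  qed
  moreover have "0 \<le> 1 / real (x m) * (\<Sum>i = k..m. c i)"
    using partial[of m] km by simp
  ultimately have nonneg: "0 \<le> (\<Sum>i = k..m. 1 / real (x i) * c i)" by linarith
  \<comment> \<open>This is the slack in \<open>ln t <= t - 1\<close> at
    \<open>t = x i / a i\<close>, divided by \<open>x i\<close>.\<close>
  define d where "d i = 1 / real (a i) - 1 / real (x i) - 1 / real (x i) * c i" for i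
  have d: "0 \<le> d i" "d i = 0 \<Longrightarrow> x i = a i" if "i \<in> {k..m}" for i
  proof -
    have pos: "0 < real (a i)" "0 < real (x i)" using a x that by auto
    have eq: "d i = 1 / real (x i) * (real (x i) / real (a i) - 1 - ln (real (x i) / real (a i)))"
      unfolding d_def c[OF that] using pos by (simp add: field_simps)
    have "ln (real (x i) / real (a i)) \<le> real (x i) / real (a i) - 1"
      using pos by (intro ln_le_minus_one) simp
    then show "0 \<le> d i" unfolding eq using pos by (intro mult_nonneg_nonneg) auto
    assume "d i = 0"
    then have "ln (real (x i) / real (a i)) = real (x i) / real (a i) - 1"
      unfolding eq using pos by simp
    then have "real (x i) / real (a i) = 1"
      using pos by (intro ln_eq_minus_one) simp_all
    then show "x i = a i" using pos by simp
  qed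
  have split: "(\<Sum>i = k..m. d i) = (\<Sum>i = k..m. 1 / real (a i)) - (\<Sum>i = k..m. 1 / real (x i))
      - (\<Sum>i = k..m. 1 / real (x i) * c i)"
    by (simp add: d_def sum_subtractf)
  have sum_d: "0 \<le> (\<Sum>i = k..m. d i)" using d(1) by (intro sum_nonneg)
  show "(\<Sum>i = k..m. 1 / real (x i)) \<le> (\<Sum>i = k..m. 1 / real (a i))"
    using split sum_d nonneg by linarith
  assume "(\<Sum>i = k..m. 1 / real (x i)) = (\<Sum>i = k..m. 1 / real (a i))"
  then have "(\<Sum>i = k..m. d i) = 0" using split sum_d nonneg by linarith
  then have "\<forall>i\<in>{k..m}. d i = 0"
    using d(1) by (subst (asm) sum_nonneg_eq_0_iff) auto
  then show "\<forall>i\<in>{k..m}. x i = a i" using d(2) by blast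
qed

section \<open>From product inequalities to unique best underapproximations\<close>

text \<open>Optimality concerns arbitrary \<open>x\<close>, whereas the majorization argument needs
  sorted ones; sorting bridges the two, as it preserves the multiset of values.\<close>

lemma ex_sorted_rearrangement:
  fixes x :: "nat \<Rightarrow> 'a::linorder"
  obtains y where "mono_on {1..m} y" "y ` {1..m} = x ` {1..m}"
    "\<And>f :: 'a \<Rightarrow> 'b::comm_monoid_add. (\<Sum>n = 1..m. f (y n)) = (\<Sum>n = 1..m. f (x n))"
proof
  define xs where "xs = map x [1..<Suc m]"
  \<comment> \<open>Lists count from 0 and sequences from 1, hence \<open>n - 1\<close>.\<close>
  define y where "y n = sort xs ! (n - 1)" for n
  have y: "map y [1..<Suc m] = sort xs"
    by (rule nth_equalityI) (auto simp: y_def xs_def simp del: upt_Suc)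
  have set_upt: "set [1..<Suc m] = {1..m}" by auto
  show "mono_on {1..m} y"
    by (rule mono_onI) (auto simp: y_def xs_def simp del: upt_Suc intro!: sorted_nth_mono)
  show "y ` {1..m} = x ` {1..m}"
    by (metis set_map set_sort set_upt xs_def y)
  show "(\<Sum>n = 1..m. f (y n)) = (\<Sum>n = 1..m. f (x n))" for f :: "'a \<Rightarrow> 'b"
  proof -
    have "(\<Sum>n = 1..m. f (z n)) = sum_list (map f (map z [1..<Suc m]))" for z :: "nat \<Rightarrow> 'a"
      by (simp only: map_map set_upt[symmetric] sum_list_distinct_conv_sum_set[symmetric]
          distinct_upt comp_def)
    moreover have "sum_list (map f (sort xs)) = sum_list (map f xs)"
      unfolding sum_mset_sum_list[symmetric] mset_map mset_sort ..
    ultimately show ?thesis by (simp only: y xs_def)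
  qed
qed

text \<open>Strong induction on \<open>m\<close>: \<open>x\<close> is cut at the last index
  \<open>k\<close> from which the tail product of \<open>a\<close> is at most that of
  \<open>x\<close>. Majorization handles the tail and the induction hypothesis the head, which is
  why \<open>prod\<close> is assumed for every length.\<close>

lemma unique_of_prod_le:
  fixes a x :: "nat \<Rightarrow> nat"
  assumes a: "\<And>n. 0 < a n"
    and prod: "\<And>m x. (\<forall>n\<in>{1..m}. 0 < x n) \<Longrightarrow>
      (\<Sum>n = 1..m. 1 / real (a n)) \<le> (\<Sum>n = 1..m. 1 / real (x n)) \<Longrightarrow>
      (\<Sum>n = 1..m. 1 / real (x n)) < \<theta> \<Longrightarrow> (\<Prod>n = 1..m. a n) \<le> (\<Prod>n = 1..m. x n)"
    and x: "\<forall>n\<in>{1..m}. 0 < x n" and mono: "mono_on {1..m} x"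
    and ge: "(\<Sum>n = 1..m. 1 / real (a n)) \<le> (\<Sum>n = 1..m. 1 / real (x n))"
    and less: "(\<Sum>n = 1..m. 1 / real (x n)) < \<theta>"
  shows "\<forall>n\<in>{1..m}. x n = a n"
  using x mono ge less
proof (induction m rule: less_induct)
  case (less m)
  show ?case
  proof (cases "m = 0")
    case False
    define P where "P k \<longleftrightarrow> k \<in> {1..m} \<and> (\<Prod>n = k..m. a n) \<le> (\<Prod>n = k..m. x n)" for k
    have "P 1" using prod[OF less.prems(1,3,4)] False by (auto simp: P_def)
    moreover have bounded: "\<And>k. P k \<Longrightarrow> k \<le> m" by (simp add: P_def)
    ultimately have k: "P (Greatest P)" and max: "\<And>j. P j \<Longrightarrow> j \<le> Greatest P"
      by (auto intro: GreatestI_nat Greatest_le_nat)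
    define k where "k = Greatest P"
    have km: "1 \<le> k" "k \<le> m" and kprod: "(\<Prod>n = k..m. a n) \<le> (\<Prod>n = k..m. x n)"
      using k by (auto simp: P_def k_def)
    \<comment> \<open>If this failed at \<open>j\<close>, maximality of \<open>k\<close> would make
      the product of \<open>x\<close> smaller on \<open>Suc j..m\<close> as well, and multiplying
      the two strict inequalities would contradict \<open>kprod\<close>.\<close>
    have prefix: "(\<Prod>n = k..j. a n) \<le> (\<Prod>n = k..j. x n)" if j: "j \<in> {k..m}" for j
    proof (rule ccontr)
      assume *: "\<not> ?thesis"
      then have "j < m" using j kprod by (cases "j = m") auto
      then have "(\<Prod>n = Suc j..m. x n) < (\<Prod>n = Suc j..m. a n)"
        using max[of "Suc j"] j km by (force simp: P_def k_def not_le)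
      then have "(\<Prod>n = k..j. x n) * (\<Prod>n = Suc j..m. x n)
          < (\<Prod>n = k..j. a n) * (\<Prod>n = Suc j..m. a n)"
        using * a by (intro mult_strict_mono) (auto intro!: prod_pos)
      moreover have "(\<Prod>n = k..j. f n) * (\<Prod>n = Suc j..m. f n) = (\<Prod>n = k..m. f n)"
        for f :: "nat \<Rightarrow> nat"
      proof -
        have "{k..m} = {k..j} \<union> {Suc j..m}" using j by auto
        then show ?thesis by (simp add: prod.union_disjoint)
      qed
      ultimately show False using kprod by simp
    qed
    have split: "(\<Sum>n = 1..m. f n) = (\<Sum>n = 1..k - 1. f n) + (\<Sum>n = k..m. f n)"
      for f :: "nat \<Rightarrow> real"
    proof -
      have "{1..m} = {1..k - 1} \<union> {k..m}" using km by auto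
      moreover have "{1..k - 1} \<inter> {k..m} = {}" by auto
      ultimately show ?thesis by (simp add: sum.union_disjoint)
    qed
    have x: "0 < x n" if "n \<in> {k..m}" for n using less.prems(1) km that by auto
    have "mono_on {k..m} x" using less.prems(2) km by (auto elim: mono_on_subset)
    note tail = sum_inverse_le_of_prod_le[OF km(2) a x this prefix]
    have head: "\<forall>n\<in>{1..k - 1}. x n = a n"
    proof (rule less.IH)
      show "k - 1 < m" using km by simp
      show "\<forall>n\<in>{1..k - 1}. 0 < x n" using less.prems(1) km by auto
      show "mono_on {1..k - 1} x" using less.prems(2) by (rule mono_on_subset) (use km in auto)
      \<comment> \<open>The tail of \<open>x\<close> contributes at most that of \<open>a\<close>,
        so its head must make up for it.\<close>
      show "(\<Sum>n = 1..k - 1. 1 / real (a n)) \<le> (\<Sum>n = 1..k - 1. 1 / real (x n))"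
        using tail(1) less.prems(3) unfolding split by linarith
      have "0 \<le> (\<Sum>n = k..m. 1 / real (x n))" by (intro sum_nonneg) simp
      then show "(\<Sum>n = 1..k - 1. 1 / real (x n)) < \<theta>"
        using less.prems(4) unfolding split by linarith
    qed
    then have "(\<Sum>n = 1..k - 1. 1 / real (x n)) = (\<Sum>n = 1..k - 1. 1 / real (a n))" by simp
    \<comment> \<open>With equal heads, the tail of \<open>x\<close> also sums to at least that of
      \<open>a\<close>, so the equality case of majorization applies.\<close>
    then have "\<forall>n\<in>{k..m}. x n = a n"
      using tail less.prems(3) unfolding split by (intro tail(2)) auto
    moreover have "{1..m} = {1..k - 1} \<union> {k..m}" using km by auto
    ultimately show ?thesis using head by blast
  qed simp
qed

text \<open>Optimality follows from uniqueness: a strictly better \<open>x\<close>, once sorted,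
  would have to coincide with \<open>a\<close> and so have the same sum.\<close>

lemma unique_best_underapprox_of_prod_le:
  fixes a :: "nat \<Rightarrow> nat"
  assumes a: "\<And>n. 0 < a n"
    and under: "(\<Sum>n = 1..m. 1 / real (a n)) < \<theta>"
    and prod: "\<And>m x. (\<forall>n\<in>{1..m}. 0 < x n) \<Longrightarrow>
      (\<Sum>n = 1..m. 1 / real (a n)) \<le> (\<Sum>n = 1..m. 1 / real (x n)) \<Longrightarrow>
      (\<Sum>n = 1..m. 1 / real (x n)) < \<theta> \<Longrightarrow> (\<Prod>n = 1..m. a n) \<le> (\<Prod>n = 1..m. x n)"
  shows "unique_best_underapprox \<theta> m a"
  unfolding unique_best_underapprox_def best_underapprox_def
proof (intro conjI allI impI under)
  fix x :: "nat \<Rightarrow> nat"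
  assume x: "\<forall>n\<in>{1..m}. 0 < x n" and less: "(\<Sum>n = 1..m. 1 / real (x n)) < \<theta>"
  show "(\<Sum>n = 1..m. 1 / real (x n)) \<le> (\<Sum>n = 1..m. 1 / real (a n))"
  proof (rule ccontr)
    assume *: "\<not> ?thesis"
    obtain y where y: "mono_on {1..m} y" "y ` {1..m} = x ` {1..m}"
      and sums: "\<And>f :: nat \<Rightarrow> real. (\<Sum>n = 1..m. f (y n)) = (\<Sum>n = 1..m. f (x n))"
      by (rule ex_sorted_rearrangement[of m x]) blast
    have sum: "(\<Sum>n = 1..m. 1 / real (y n)) = (\<Sum>n = 1..m. 1 / real (x n))"
      by (rule sums)
    have "\<forall>n\<in>{1..m}. 0 < y n" using x y(2) by (metis imageE imageI)
    then have "\<forall>n\<in>{1..m}. y n = a n"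
      using * less by (intro unique_of_prod_le[OF a prod _ y(1)]) (simp_all only: sum not_le less_imp_le)
    then have "(\<Sum>n = 1..m. 1 / real (y n)) = (\<Sum>n = 1..m. 1 / real (a n))" by simp
    with sum * show False by simp
  qed
qed (rule unique_of_prod_le[OF a prod], assumption+)

section \<open>Common denominators and the gap below a fraction\<close>

lemma sum_inverse_mult_prod_in_Ints:
  fixes x :: "'a \<Rightarrow> nat"
  assumes "\<And>n. n \<in> A \<Longrightarrow> 0 < x n"
  shows "(\<Sum>n\<in>A. 1 / real (x n)) * real (\<Prod>n\<in>A. x n) \<in> \<int>"
proof (cases "finite A")
  case True
  have "1 / real (x n) * real (\<Prod>n\<in>A. x n) = real (\<Prod>n\<in>A - {n}. x n)" if "n \<in> A" for n
    using assms[OF that] by (simp add: prod.remove[OF True that])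
  then have "(\<Sum>n\<in>A. 1 / real (x n)) * real (\<Prod>n\<in>A. x n) = (\<Sum>n\<in>A. real (\<Prod>n\<in>A - {n}. x n))"
    unfolding sum_distrib_right by (intro sum.cong) auto
  then show ?thesis by (auto simp del: of_nat_prod intro: Ints_sum)
\<comment> \<open>For infinite \<open>A\<close> the sum is 0 by convention, and so is the whole
  expression.\<close>
qed simp

text \<open>Multiplied by \<open>q\<close> and the product of the \<open>x n\<close>, the gap
  becomes a positive integer, hence at least 1.\<close>

lemma underapprox_gap:
  fixes x :: "nat \<Rightarrow> nat"
  assumes "0 < q" and x: "\<And>n. n \<in> A \<Longrightarrow> 0 < x n"
    and less: "(\<Sum>n\<in>A. 1 / real (x n)) < real p / real q"
  shows "1 / (real q * real (\<Prod>n\<in>A. x n)) \<le> real p / real q - (\<Sum>n\<in>A. 1 / real (x n))"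
proof -
  define s where "s = (\<Sum>n\<in>A. 1 / real (x n))"
  define P where "P = real (\<Prod>n\<in>A. x n)"
  have "0 < P" unfolding P_def using x by (simp add: prod_pos)
  have eq: "(real p / real q - s) * (real q * P) = real p * P - real q * (s * P)"
    using \<open>0 < q\<close> by (simp add: field_simps)
  have "s * P \<in> \<int>" unfolding s_def P_def by (rule sum_inverse_mult_prod_in_Ints[OF x])
  moreover have "P \<in> \<int>" unfolding P_def by (rule Ints_of_nat)
  ultimately have "(real p / real q - s) * (real q * P) \<in> \<int>" unfolding eq by simp
  moreover have "0 < (real p / real q - s) * (real q * P)"
    using less \<open>0 < q\<close> \<open>0 < P\<close> by (simp add: s_def)
  ultimately have "1 \<le> (real p / real q - s) * (real q * P)"
    by (metis Ints_cases of_int_0_less_iff of_int_1_le_iff int_one_le_iff_zero_less)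
  then show ?thesis
    using \<open>0 < q\<close> \<open>0 < P\<close> unfolding s_def[symmetric] P_def[symmetric]
    by (simp add: pos_divide_le_eq)
qed

section \<open>The greedy sequence and its remainders\<close>

lemma G_eqI:
  assumes "0 < \<theta>" "0 < n" "real n - 1 \<le> 1 / \<theta>" "1 / \<theta> < real n"
  shows "G \<theta> = n"
proof -
  have "\<lfloor>1 / \<theta>\<rfloor> = int n - 1" using assms by (intro floor_unique) auto
  then show ?thesis using assms by (simp add: G_def nat_diff_distrib)
qed

lemma greedy_pos: "0 < greedy \<theta> n"
  by (subst greedy.simps) (simp add: G_def)

lemma greedy_1: "greedy \<theta> 1 = G \<theta>"
  by (subst greedy.simps) simp

lemma greedy_Suc: "greedy \<theta> (Suc m) = G (\<theta> - (\<Sum>n = 1..m. 1 / real (greedy \<theta> n)))"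
  by (subst greedy.simps) (simp only: atLeastLessThanSuc_atLeastAtMost)

context
  fixes p q :: nat
  assumes p: "0 < p" and q: "0 < q" and odd_q: "odd q" and ups: "Upsilon p q = 2"
begin

text \<open>The divisibility holds because the least element is attained. Since \<open>q + 1\<close>
  is even, \<open>p = 1\<close> and \<open>p = 2\<close> would both divide it, forcing
  \<open>Upsilon p q = 1\<close>.\<close>

lemma Upsilon_2_dvd: "p dvd q + 2" and Upsilon_2_gt: "2 < p"
proof -
  \<comment> \<open>The positive number \<open>(p - 1) * q + p\<close> witnesses that the set under
    \<open>LEAST\<close> is nonempty.\<close>
  have "q + ((p - 1) * q + p) = p * (q + 1)" using p by (cases p) simp_all
  then have "p dvd q + ((p - 1) * q + p)" by (rule dvdI)
  then have "\<exists>j. 0 < j \<and> p dvd q + j" using p by (intro exI[of _ "(p - 1) * q + p"] conjI) simp_all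
  then have "0 < Upsilon p q \<and> p dvd q + Upsilon p q"
    unfolding Upsilon_def by (rule LeastI_ex)
  then show dvd: "p dvd q + 2" by (simp add: ups)
  have "\<not> p dvd q + 1"
    using not_less_Least[of 1 "\<lambda>j. 0 < j \<and> p dvd q + j"] ups by (simp add: Upsilon_def)
  then have "p \<noteq> 1" "p \<noteq> 2" using odd_q by auto
  with p show "2 < p" by simp
qed

private abbreviation (input) a :: "nat \<Rightarrow> nat" where "a \<equiv> greedy (real p / real q)"

text \<open>With \<open>q + 2 = p * k\<close>, the reciprocal \<open>q / p\<close> equals
  \<open>k - 2 / p\<close>, and \<open>2 < p\<close> puts its floor at \<open>k - 1\<close>.\<close>

lemma greedy_first: "p * a 1 = q + 2"
proof -
  obtain k where k: "q + 2 = p * k" using Upsilon_2_dvd by blast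
  have rk: "real q = real p * real k - 2" using arg_cong[OF k, of real] by simp
  have "0 < k" using k by (cases k) auto
  have "G (real p / real q) = k"
  proof (rule G_eqI)
    show "real k - 1 \<le> 1 / (real p / real q)" "1 / (real p / real q) < real k"
      using p Upsilon_2_gt by (simp_all add: rk field_simps)
  qed (use p q \<open>0 < k\<close> in auto)
  then show ?thesis using k by (simp only: greedy_1)
qed

lemma odd_greedy_first: "odd (q * a 1)"
  using greedy_first odd_q by (metis even_add even_mult_iff even_numeral)

lemma remainder_first: "real p / real q - 1 / real (a 1) = 2 / real (q * a 1)"
proof -
  have "real p * real (a 1) = real q + 2" using arg_cong[OF greedy_first, of real] by simp
  then show ?thesis using q greedy_pos[of _ 1] by (simp add: field_simps)
qed

text \<open>Writing the odd number \<open>q * a 1\<close> as \<open>2 * k + 1\<close>, the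
  reciprocal of the remainder is \<open>k + 1/2\<close>, so \<open>G\<close> returns
  \<open>k + 1\<close>.\<close>

lemma greedy_second: "2 * a 2 = q * a 1 + 1"
proof -
  obtain k where k: "q * a 1 = 2 * k + 1" using odd_greedy_first by (rule oddE)
  have "a 2 = G (2 / real (q * a 1))"
    using greedy_Suc[of _ 1] remainder_first by (simp add: numeral_2_eq_2)
  also have "\<dots> = k + 1"
    unfolding k by (rule G_eqI) (simp_all add: field_simps)
  finally show ?thesis using k by simp
qed

text \<open>At \<open>m = 2\<close> the numerator drops from 2 to
  \<open>2 * a 2 - q * a 1 = 1\<close>. From then on a remainder \<open>1 / N\<close> yields the
  next term \<open>N + 1\<close> and the remainder \<open>1 / (N * (N + 1))\<close>.\<close>

lemma remainder:
  assumes "2 \<le> m"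
  shows "real p / real q - (\<Sum>n = 1..m. 1 / real (a n)) = 1 / real (q * (\<Prod>n = 1..m. a n))"
  using assms
proof (induction m rule: dec_induct)
  case base
  have N: "0 < real (q * a 1)" using q greedy_pos by simp
  have "2 * real (a 2) = real (q * a 1) + 1" using arg_cong[OF greedy_second, of real] by simp
  then have "2 / real (q * a 1) - 1 / real (a 2) = 1 / (real (q * a 1) * real (a 2))"
    using N greedy_pos[of _ 2] by (simp add: field_simps del: of_nat_mult)
  then show ?case using remainder_first by (simp add: numeral_2_eq_2 mult.assoc)
next
  case (step m)
  define N where "N = q * (\<Prod>n = 1..m. a n)"
  have "0 < N" using q greedy_pos by (simp add: N_def prod_pos)
  have "a (Suc m) = G (1 / real N)"
    unfolding greedy_Suc step.IH N_def ..
  \<comment> \<open>The reciprocal is exactly \<open>N\<close>; adding 1 to the floor keeps the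
    approximation strictly below the target.\<close>
  also have "\<dots> = N + 1"
    by (rule G_eqI) (use \<open>0 < N\<close> in auto)
  finally have next_term: "a (Suc m) = N + 1" .
  have "real p / real q - (\<Sum>n = 1..Suc m. 1 / real (a n)) = 1 / real N - 1 / real (a (Suc m))"
    using step.IH by (simp add: N_def)
  also have "\<dots> = 1 / real (N * a (Suc m))"
    using \<open>0 < N\<close> unfolding next_term by (simp add: field_simps)
  finally show ?case by (simp add: N_def mult.assoc)
qed

lemma greedy_underapprox: "(\<Sum>n = 1..m. 1 / real (a n)) < real p / real q"
proof -
  consider "m = 0" | "m = 1" | "2 \<le> m" by linarith
  then show ?thesis
  proof cases
    case 2
    have "0 < 2 / real (q * a 1)" using q greedy_pos by simp
    then have "1 / real (a 1) < real p / real q" using remainder_first by linarith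
    then show ?thesis using 2 by simp
  next
    case 3
    have "0 < 1 / real (q * (\<Prod>n = 1..m. a n))" using q greedy_pos by (simp add: prod_pos)
    then show ?thesis using remainder[OF 3] by linarith
  qed (use p q in simp)
qed

text \<open>For \<open>m >= 2\<close> the gap left by \<open>x\<close> is at least
  \<open>1 / (q * prod x)\<close> by integrality and at most the greedy remainder
  \<open>1 / (q * prod a)\<close>; comparing denominators gives the claim.\<close>

lemma greedy_prod_le:
  fixes x :: "nat \<Rightarrow> nat"
  assumes x: "\<forall>n\<in>{1..m}. 0 < x n"
    and ge: "(\<Sum>n = 1..m. 1 / real (a n)) \<le> (\<Sum>n = 1..m. 1 / real (x n))"
    and less: "(\<Sum>n = 1..m. 1 / real (x n)) < real p / real q"
  shows "(\<Prod>n = 1..m. a n) \<le> (\<Prod>n = 1..m. x n)"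
proof -
  consider "m = 0" | "m = 1" | "2 \<le> m" by linarith
  then show ?thesis
  proof cases
    case 2
    \<comment> \<open>Here the greedy remainder has numerator 2, so the gap bound is too weak;
      instead \<open>x 1 > q / p >= a 1 - 1\<close> and integrality are used.\<close>
    have "real p * real (a 1) = real q + 2" using arg_cong[OF greedy_first, of real] by simp
    then have "real (a 1) - 1 \<le> real q / real p"
      using Upsilon_2_gt by (simp add: field_simps)
    moreover have "real q / real p < real (x 1)"
      using less x 2 p q by (simp add: field_simps)
    ultimately have "a 1 \<le> x 1" by linarith
    then show ?thesis using 2 by simp
  next
    case 3
    have pos: "0 < (\<Prod>n = 1..m. a n)" "0 < (\<Prod>n = 1..m. x n)"
      using greedy_pos x by (simp_all add: prod_pos)
    have "1 / (real q * real (\<Prod>n = 1..m. x n)) \<le> 1 / real (q * (\<Prod>n = 1..m. a n))"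
      using underapprox_gap[OF q _ less] x ge remainder[OF 3] by force
    then have "real q * real (\<Prod>n = 1..m. a n) \<le> real q * real (\<Prod>n = 1..m. x n)"
      using pos q by (simp add: field_simps del: of_nat_prod)
    then show ?thesis using q by (simp del: of_nat_prod)
  qed simp
qed

end

theorem theorem1p12:
  fixes p q :: nat
  assumes "0 < p" and "0 < q" and "p < q" and "odd q" and "Upsilon p q = 2"
  shows "\<forall>m :: nat. 1 \<le> m \<longrightarrow>
           unique_best_underapprox (real p / real q) m (greedy (real p / real q))"
  using assms greedy_pos greedy_underapprox greedy_prod_le
  by (intro allI impI unique_best_underapprox_of_prod_le) auto

end
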